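(* Let $A$ be a finite-dimensional complex evolution algebra with natural basis $B=\{e_1,\dots,e_n\}$ and structure matrix $W=(\omega_{ij})$ (so $e_j^2=\sum_i\omega_{ij}e_i$). Then $A$ is m-semisimple if and only if for every $i=1,\dots,n$ there exists $a=\sum_{k=1}^n\alpha_ke_k\in\mathrm{lin}\{e_j^2:j\in D(i)\cup\{i\}\}$ such that the matrix $W\,\mathrm{diag}(\alpha_1,\dots,\alpha_n)$ has a non-zero eigenvalue.
   Context: An evolution algebra is an algebra with a basis $\{e_i\}$ (natural basis) with $e_ie_j=0$ for $i\neq j$. Descendents: $D^1(i)=\{j:\omega_{ji}\neq0\}$, $D^n(i)=\bigcup_{j\in D^{n-1}(i)}D^1(j)$, $D(i)=\bigcup_{n\ge1}D^n(i)$. For a complex algebra $A$: if $A$ has a unit $e$ put $\tilde A=A$, else $\tilde A=A\oplus\mathbb{C}\mathbf1$ (unitization, product $(a+\lambda\mathbf1)(b+\mu\mathbf1)=ab+\lambda b+\mu a+\lambda\mu\mathbf1$, $e=\mathbf1$). $x\in\tilde A$ is m-invertible if $L_x(y)=xy$ and $R_x(y)=yx$ are bijective on $\tilde A$; the m-spectrum is $\sigma^A_m(a)=\{\lambda\in\mathbb{C}:a-\lambda e\text{ not m-invertible}\}$ and $\rho_m(a)=\sup\{|\lambda|:\lambda\in\sigma^A_m(a)\}$ ($=0$ if empty). $A$ is m-semisimple if $\{0\}$ is the only ideal of $A$ contained in $\{a\in A:\rho_m(a)=0\}$. *)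

theory Defs
  imports "Jordan_Normal_Form.Char_Poly" "HOL-Library.Extended_Real"
begin

text \<open>A complex evolution algebra of dimension n with natural basis e_0,...,e_(n-1)
  is modelled on carrier_vec n (coordinates w.r.t. the natural basis).  The structure
  matrix W (n x n) satisfies e_j^2 = sum_i W(i,j) e_i, so x y = W (x o y),
  where o is the coordinatewise product.\<close>

definition evo_mult :: "complex mat \<Rightarrow> complex vec \<Rightarrow> complex vec \<Rightarrow> complex vec" where
  "evo_mult W x y = W *\<^sub>v vec (dim_col W) (\<lambda>j. x $ j * y $ j)"

text \<open>m-invertibility on a carrier: left and right multiplication are bijective.\<close>
definition m_invertible_on :: "'a set \<Rightarrow> ('a \<Rightarrow> 'a \<Rightarrow> 'a) \<Rightarrow> 'a \<Rightarrow> bool" where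
  "m_invertible_on S m x \<longleftrightarrow> bij_betw (m x) S S \<and> bij_betw (\<lambda>y. m y x) S S"

definition evo_is_unit :: "complex mat \<Rightarrow> complex vec \<Rightarrow> bool" where
  "evo_is_unit W e \<longleftrightarrow> e \<in> carrier_vec (dim_col W) \<and>
     (\<forall>x \<in> carrier_vec (dim_col W). evo_mult W e x = x \<and> evo_mult W x e = x)"

text \<open>Product on the unitization A (+) C 1:
  (a + l 1)(b + m 1) = ab + l b + m a + l m 1.\<close>
definition unitz_mult :: "complex mat \<Rightarrow> complex vec \<times> complex \<Rightarrow> complex vec \<times> complex \<Rightarrow> complex vec \<times> complex" where
  "unitz_mult W p q = (evo_mult W (fst p) (fst q) + snd p \<cdot>\<^sub>v fst q + snd q \<cdot>\<^sub>v fst p, snd p * snd q)"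

text \<open>m-spectrum of a in A: if A has a unit e, computed in A itself; otherwise in the
  unitization, where a - l 1 is the pair (a, -l).\<close>
definition m_spectrum :: "complex mat \<Rightarrow> complex vec \<Rightarrow> complex set" where
  "m_spectrum W a =
     (if \<exists>e. evo_is_unit W e
      then {l. \<not> m_invertible_on (carrier_vec (dim_col W)) (evo_mult W)
                    (a - l \<cdot>\<^sub>v (SOME e. evo_is_unit W e))}
      else {l. \<not> m_invertible_on (carrier_vec (dim_col W) \<times> UNIV) (unitz_mult W) (a, - l)})"

text \<open>m-spectral radius (extended real, to allow an unbounded spectrum; 0 if empty).\<close>
definition m_spectral_radius :: "complex mat \<Rightarrow> complex vec \<Rightarrow> ereal" where
  "m_spectral_radius W a =
     (if m_spectrum W a = {} then 0 else Sup ((\<lambda>l. ereal (cmod l)) ` m_spectrum W a))"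

text \<open>(Two-sided) ideals of the evolution algebra.\<close>
definition evo_ideal :: "complex mat \<Rightarrow> complex vec set \<Rightarrow> bool" where
  "evo_ideal W I \<longleftrightarrow> I \<subseteq> carrier_vec (dim_col W) \<and> 0\<^sub>v (dim_col W) \<in> I \<and>
     (\<forall>x\<in>I. \<forall>y\<in>I. x + y \<in> I) \<and> (\<forall>c. \<forall>x\<in>I. c \<cdot>\<^sub>v x \<in> I) \<and>
     (\<forall>a\<in>carrier_vec (dim_col W). \<forall>x\<in>I. evo_mult W a x \<in> I \<and> evo_mult W x a \<in> I)"

definition m_semisimple :: "complex mat \<Rightarrow> bool" where
  "m_semisimple W \<longleftrightarrow>
     (\<forall>I. evo_ideal W I \<and> I \<subseteq> {a \<in> carrier_vec (dim_col W). m_spectral_radius W a = 0}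
          \<longrightarrow> I = {0\<^sub>v (dim_col W)})"

text \<open>Descendents: D^1(i) = {j. W(j,i) \<noteq> 0}, D(i) = union of all D^k(i), k \<ge> 1,
  i.e. the image of i under the transitive closure of the one-step relation.\<close>
definition desc_rel :: "complex mat \<Rightarrow> (nat \<times> nat) set" where
  "desc_rel W = {(i, j). i < dim_col W \<and> j < dim_col W \<and> W $$ (j, i) \<noteq> 0}"

definition descendents :: "complex mat \<Rightarrow> nat \<Rightarrow> nat set" where
  "descendents W i = (desc_rel W)\<^sup>+ `` {i}"

text \<open>Linear span of the squares e_j^2 = col W j, j in S (finite linear combinations).\<close>
definition lin_squares :: "complex mat \<Rightarrow> nat set \<Rightarrow> complex vec set" where
  "lin_squares W S = {a. \<exists>c. a = finsum_vec TYPE(complex) (dim_row W)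
        (\<lambda>j. c j \<cdot>\<^sub>v col W j) (S \<inter> {..<dim_col W})}"

definition diag_of :: "complex vec \<Rightarrow> complex mat" where
  "diag_of a = mat (dim_vec a) (dim_vec a) (\<lambda>(i, j). if i = j then a $ i else 0)"

end

theory Submission
  imports Defs
begin

text \<open>In coordinates the product is \<open>x y = W (x \<circ> y)\<close>, so multiplication by \<open>a\<close> is the matrix
  \<open>W diag(a)\<close>. Whether or not \<open>A\<close> is unital, a non-zero \<open>\<lambda>\<close> lies in the m-spectrum of \<open>a\<close> exactly
  when it is an eigenvalue of \<open>W diag(a)\<close>, so \<open>\<rho>\<^sub>m(a) = 0\<close> means that \<open>W diag(a)\<close> has no non-zero
  eigenvalue. An ideal containing \<open>x\<close> with \<open>x\<^sub>i \<noteq> 0\<close> contains \<open>e\<^sub>i x = x\<^sub>i e\<^sub>i\<^sup>2\<close>, hence every \<open>e\<^sub>j\<^sup>2\<close>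
  with \<open>j \<in> D(i)\<close> and so all of \<open>lin{e\<^sub>j\<^sup>2 : j \<in> D(i) \<union> {i}}\<close>. Conversely this span is itself an
  ideal, because its elements are supported on \<open>D(i) \<union> {i}\<close>, a set closed under taking descendents;
  and if \<open>e\<^sub>i\<^sup>2 = 0\<close> then the line \<open>\<complex> e\<^sub>i\<close> is an ideal on which the product vanishes.\<close>

lemma mult_mat_vec_unit_vec:
  assumes "(A :: 'a :: semiring_1 mat) \<in> carrier_mat m n" "k < n"
  shows "A *\<^sub>v unit_vec n k = col A k"
proof (rule eq_vecI)
  fix i assume "i < dim_vec (col A k)"
  thus "(A *\<^sub>v unit_vec n k) $ i = col A k $ i"
    using assms scalar_prod_right_unit[of k n "row A i"] by simp
qed (use assms in simp)

lemma ex_index_nonzero_vec: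
  assumes "v \<in> carrier_vec n" "v \<noteq> 0\<^sub>v n"
  obtains j where "j < n" "v $ j \<noteq> 0"
proof (rule ccontr)
  assume "\<not> thesis"
  hence "v = 0\<^sub>v n" using that assms(1) by (intro eq_vecI) auto
  thus False using assms(2) by contradiction
qed

lemma diag_of_carrier [simp]: "a \<in> carrier_vec n \<Longrightarrow> diag_of a \<in> carrier_mat n n"
  by (auto simp: diag_of_def)

lemma diag_of_mult_vec:
  assumes "a \<in> carrier_vec n" "y \<in> carrier_vec n"
  shows "diag_of a *\<^sub>v y = vec n (\<lambda>j. a $ j * y $ j)"
proof (rule eq_vecI)
  fix i assume i: "i < dim_vec (vec n (\<lambda>j. a $ j * y $ j))"
  hence "(diag_of a *\<^sub>v y) $ i = (\<Sum>k<n. (if i = k then a $ i else 0) * y $ k)"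
    using assms by (simp add: diag_of_def mult_mat_vec_def scalar_prod_def row_def atLeast0LessThan)
  also have "\<dots> = a $ i * y $ i"
    using i by (simp add: if_distrib[of "\<lambda>c. c * _"] sum.delta cong: if_cong)
  finally show "(diag_of a *\<^sub>v y) $ i = vec n (\<lambda>j. a $ j * y $ j) $ i" using i by simp
qed (use assms in \<open>simp add: diag_of_def\<close>)

subsection \<open>The evolution product\<close>

lemma evo_mult_commute: "evo_mult W x y = evo_mult W y x"
  unfolding evo_mult_def by (simp add: mult.commute)

lemma evo_mult_eq_mult_diag_of:
  assumes "W \<in> carrier_mat n n" "a \<in> carrier_vec n" "y \<in> carrier_vec n"
  shows "evo_mult W a y = (W * diag_of a) *\<^sub>v y"
  using assms by (simp add: evo_mult_def diag_of_mult_vec assoc_mult_mat_vec[of _ n n _ n])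

lemma evo_mult_unit_vec:
  assumes "W \<in> carrier_mat n n" "y \<in> carrier_vec n" "k < n"
  shows "evo_mult W (c \<cdot>\<^sub>v unit_vec n k) y = (c * y $ k) \<cdot>\<^sub>v col W k"
proof -
  have "vec (dim_col W) (\<lambda>j. (c \<cdot>\<^sub>v unit_vec n k) $ j * y $ j) = (c * y $ k) \<cdot>\<^sub>v unit_vec n k"
    using assms by (intro eq_vecI) auto
  thus ?thesis
    using assms mult_mat_vec[OF assms(1)] mult_mat_vec_unit_vec[OF assms(1,3)]
    by (simp add: evo_mult_def)
qed

lemma evo_mult_diff_left:
  assumes "W \<in> carrier_mat n n" "a \<in> carrier_vec n" "e \<in> carrier_vec n" "y \<in> carrier_vec n"
  shows "evo_mult W (a - l \<cdot>\<^sub>v e) y = evo_mult W a y - l \<cdot>\<^sub>v evo_mult W e y"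
proof -
  have "vec n (\<lambda>j. (a - l \<cdot>\<^sub>v e) $ j * y $ j) = vec n (\<lambda>j. a $ j * y $ j) - l \<cdot>\<^sub>v vec n (\<lambda>j. e $ j * y $ j)"
    using assms by (intro eq_vecI) (auto simp: algebra_simps)
  thus ?thesis
    using assms by (simp add: evo_mult_def mult_minus_distrib_mat_vec[of W n n] mult_mat_vec[of W n n])
qed

subsection \<open>The m-spectrum\<close>

lemma bij_betw_mult_mat_vec_iff_det:
  assumes A: "(A :: 'a :: field mat) \<in> carrier_mat n n"
  shows "bij_betw ((*\<^sub>v) A) (carrier_vec n) (carrier_vec n) \<longleftrightarrow> det A \<noteq> 0"
proof
  assume bij: "bij_betw ((*\<^sub>v) A) (carrier_vec n) (carrier_vec n)"
  show "det A \<noteq> 0"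
  proof
    assume "det A = 0"
    then obtain v where v: "v \<in> carrier_vec n" "v \<noteq> 0\<^sub>v n" "A *\<^sub>v v = 0\<^sub>v n"
      using det_0_iff_vec_prod_zero_field[OF A] by blast
    have "A *\<^sub>v 0\<^sub>v n = 0\<^sub>v n" using A by auto
    thus False using v bij_betw_imp_inj_on[OF bij] by (metis inj_onD zero_carrier_vec)
  qed
next
  assume "det A \<noteq> 0"
  then obtain B where B: "B \<in> carrier_mat n n" "B * A = 1\<^sub>m n" "A * B = 1\<^sub>m n"
    using det_non_zero_imp_unit[OF A, of undefined] unfolding Units_def ring_mat_def by auto
  show "bij_betw ((*\<^sub>v) A) (carrier_vec n) (carrier_vec n)"
  proof (rule bij_betwI[where g="(*\<^sub>v) B"])
    fix x :: "'a vec" assume x: "x \<in> carrier_vec n"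
    show "B *\<^sub>v (A *\<^sub>v x) = x" using A B x by (simp flip: assoc_mult_mat_vec)
    show "A *\<^sub>v (B *\<^sub>v x) = x" using A B x by (simp flip: assoc_mult_mat_vec)
  qed (use A B in auto)
qed

lemma bij_betw_shift_iff_not_eigenvalue:
  assumes M: "(M :: 'a :: field mat) \<in> carrier_mat n n"
  shows "bij_betw (\<lambda>y. M *\<^sub>v y - l \<cdot>\<^sub>v y) (carrier_vec n) (carrier_vec n) \<longleftrightarrow> \<not> eigenvalue M l"
proof -
  have "char_matrix M l *\<^sub>v y = M *\<^sub>v y - l \<cdot>\<^sub>v y" if "y \<in> carrier_vec n" for y
    using M that by (auto simp: char_matrix_def add_mult_distrib_mat_vec[of _ n n] intro!: eq_vecI)
  hence "bij_betw (\<lambda>y. M *\<^sub>v y - l \<cdot>\<^sub>v y) (carrier_vec n) (carrier_vec n)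
      \<longleftrightarrow> bij_betw ((*\<^sub>v) (char_matrix M l)) (carrier_vec n) (carrier_vec n)"
    by (intro bij_betw_cong) simp
  also have "\<dots> \<longleftrightarrow> \<not> eigenvalue M l"
    using M by (simp add: bij_betw_mult_mat_vec_iff_det eigenvalue_det)
  finally show ?thesis .
qed

lemma bij_betw_unitizationD:
  fixes f :: "'a :: field vec \<Rightarrow> 'a vec"
  assumes l: "l \<noteq> 0" and a: "a \<in> carrier_vec n" and f: "f \<in> carrier_vec n \<rightarrow> carrier_vec n"
    and bij: "bij_betw (\<lambda>p. (f (fst p) + snd p \<cdot>\<^sub>v a, - l * snd p)) (carrier_vec n \<times> UNIV) (carrier_vec n \<times> UNIV)"
      (is "bij_betw ?g ?S _")
  shows "bij_betw f (carrier_vec n) (carrier_vec n)"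
  unfolding bij_betw_def
proof
  show "inj_on f (carrier_vec n)"
  proof (rule inj_onI)
    fix y y' assume y: "y \<in> carrier_vec n" "y' \<in> carrier_vec n" and "f y = f y'"
    hence "?g (y, 0) = ?g (y', 0)" by simp
    hence "(y, 0 :: 'a) = (y', 0)" by (rule inj_onD[OF bij_betw_imp_inj_on[OF bij]]) (use y in auto)
    thus "y = y'" by simp
  qed
  show "f ` carrier_vec n = carrier_vec n"
  proof
    show "carrier_vec n \<subseteq> f ` carrier_vec n"
    proof
      fix z :: "'a vec" assume "z \<in> carrier_vec n"
      hence "(z, 0) \<in> ?g ` ?S" using bij_betw_imp_surj_on[OF bij] by auto
      then obtain y \<mu> where y: "y \<in> carrier_vec n" and "?g (y, \<mu>) = (z, 0)" by auto
      moreover from this have "\<mu> = 0" using l by simp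
      ultimately have "z = f y + 0 \<cdot>\<^sub>v a" by simp
      also have "\<dots> = f y" using funcset_mem[OF f y] a by (auto intro!: eq_vecI)
      finally show "z \<in> f ` carrier_vec n" using y by simp
    qed
  qed (use f in auto)
qed

lemma bij_betw_unitizationI:
  fixes f :: "'a :: field vec \<Rightarrow> 'a vec"
  assumes l: "l \<noteq> 0" and a: "a \<in> carrier_vec n" and f: "f \<in> carrier_vec n \<rightarrow> carrier_vec n"
    and bij: "bij_betw f (carrier_vec n) (carrier_vec n)"
  shows "bij_betw (\<lambda>p. (f (fst p) + snd p \<cdot>\<^sub>v a, - l * snd p)) (carrier_vec n \<times> UNIV) (carrier_vec n \<times> UNIV)"
    (is "bij_betw ?g ?S _")
  unfolding bij_betw_def
proof
  show "inj_on ?g ?S"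
  proof (rule inj_onI)
    fix p q assume p: "p \<in> ?S" and q: "q \<in> ?S" and pq: "?g p = ?g q"
    have fpq: "f (fst p) \<in> carrier_vec n" "f (fst q) \<in> carrier_vec n" using p q f by auto
    have snd: "snd p = snd q" using pq l by simp
    have sum: "f (fst p) + snd p \<cdot>\<^sub>v a = f (fst q) + snd p \<cdot>\<^sub>v a" using pq snd by simp
    have "f (fst p) $ i = f (fst q) $ i" if "i < n" for i
      using arg_cong[OF sum, of "\<lambda>v. v $ i"] that fpq a by simp
    hence "f (fst p) = f (fst q)" using fpq by (intro eq_vecI) auto
    hence "fst p = fst q" using bij_betw_imp_inj_on[OF bij] p q by (auto dest: inj_onD)
    thus "p = q" using snd by (simp add: prod_eq_iff)
  qed
  show "?g ` ?S = ?S"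
  proof
    show "?S \<subseteq> ?g ` ?S"
    proof
      fix q assume q: "q \<in> ?S"
      define \<mu> where "\<mu> = - snd q / l"
      have "fst q - \<mu> \<cdot>\<^sub>v a \<in> carrier_vec n" using q a by auto
      then obtain y where y: "y \<in> carrier_vec n" "f y = fst q - \<mu> \<cdot>\<^sub>v a"
        using bij_betw_imp_surj_on[OF bij] by (metis imageE)
      have "f y + \<mu> \<cdot>\<^sub>v a = fst q" using y q a by (auto intro!: eq_vecI)
      moreover have "- l * \<mu> = snd q" using l by (simp add: \<mu>_def)
      ultimately have "?g (y, \<mu>) = q" by (simp add: prod_eq_iff)
      thus "q \<in> ?g ` ?S" using y by force
    qed
  qed (use f a in \<open>auto simp: Pi_iff\<close>)
qed

lemma m_invertible_on_iff_bij_betw_left: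
  assumes "\<And>y. y \<in> S \<Longrightarrow> m y x = m x y"
  shows "m_invertible_on S m x \<longleftrightarrow> bij_betw (m x) S S"
proof -
  have "bij_betw (\<lambda>y. m y x) S S \<longleftrightarrow> bij_betw (m x) S S"
    by (rule bij_betw_cong) (use assms in simp)
  thus ?thesis by (simp add: m_invertible_on_def)
qed

lemma unitz_mult_commute:
  assumes "W \<in> carrier_mat n n" "fst p \<in> carrier_vec n" "fst q \<in> carrier_vec n"
  shows "unitz_mult W p q = unitz_mult W q p"
  using assms evo_mult_commute[of W "fst p" "fst q"]
  by (auto simp: unitz_mult_def mult.commute intro!: eq_vecI)

text \<open>Only non-zero \<open>\<lambda>\<close> matter: without a unit, \<open>0\<close> always lies in the m-spectrum.\<close>

lemma m_spectrum_nonzero_iff_eigenvalue: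
  assumes W: "W \<in> carrier_mat n n" and a: "a \<in> carrier_vec n" and l: "l \<noteq> 0"
  shows "l \<in> m_spectrum W a \<longleftrightarrow> eigenvalue (W * diag_of a) l"
proof -
  let ?M = "W * diag_of a"
  let ?shift = "\<lambda>y. ?M *\<^sub>v y - l \<cdot>\<^sub>v y"
  have M: "?M \<in> carrier_mat n n" using W a by simp
  have shift: "bij_betw ?shift (carrier_vec n) (carrier_vec n) \<longleftrightarrow> \<not> eigenvalue ?M l"
    by (rule bij_betw_shift_iff_not_eigenvalue[OF M])
  show ?thesis
  proof (cases "\<exists>e. evo_is_unit W e")
    case True
    define e where "e = (SOME e. evo_is_unit W e)"
    have "evo_is_unit W e" unfolding e_def using True by (rule someI_ex)
    hence e: "e \<in> carrier_vec n" "\<And>y. y \<in> carrier_vec n \<Longrightarrow> evo_mult W e y = y"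
      using W by (auto simp: evo_is_unit_def)
    have "evo_mult W (a - l \<cdot>\<^sub>v e) y = ?shift y" if "y \<in> carrier_vec n" for y
      using evo_mult_diff_left[OF W a e(1) that] evo_mult_eq_mult_diag_of[OF W a that] e(2)[OF that]
      by simp
    hence "m_invertible_on (carrier_vec n) (evo_mult W) (a - l \<cdot>\<^sub>v e)
        \<longleftrightarrow> bij_betw ?shift (carrier_vec n) (carrier_vec n)"
      by (simp add: m_invertible_on_iff_bij_betw_left evo_mult_commute cong: bij_betw_cong)
    thus ?thesis using True W shift by (simp add: m_spectrum_def e_def)
  next
    case False
    let ?S = "(carrier_vec n :: complex vec set) \<times> (UNIV :: complex set)"
    have "m_invertible_on ?S (unitz_mult W) (a, - l) \<longleftrightarrow> bij_betw (unitz_mult W (a, - l)) ?S ?S"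
      by (rule m_invertible_on_iff_bij_betw_left) (use unitz_mult_commute[OF W] a in auto)
    also have "\<dots> \<longleftrightarrow> bij_betw (\<lambda>p. (?shift (fst p) + snd p \<cdot>\<^sub>v a, - l * snd p)) ?S ?S"
    proof (rule bij_betw_cong)
      fix p assume "p \<in> ?S"
      thus "unitz_mult W (a, - l) p = (?shift (fst p) + snd p \<cdot>\<^sub>v a, - l * snd p)"
        using evo_mult_eq_mult_diag_of[OF W a, of "fst p"] M a
        by (auto simp: unitz_mult_def intro!: eq_vecI)
    qed
    also have "\<dots> \<longleftrightarrow> bij_betw ?shift (carrier_vec n) (carrier_vec n)"
      using bij_betw_unitizationI[OF l a, of ?shift] bij_betw_unitizationD[OF l a, of ?shift] M by auto
    finally show ?thesis using False W shift by (simp add: m_spectrum_def)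
  qed
qed

lemma m_spectral_radius_eq_0_iff_subset: "m_spectral_radius W a = 0 \<longleftrightarrow> m_spectrum W a \<subseteq> {0}"
proof (cases "m_spectrum W a = {}")
  case False
  then obtain l where "l \<in> m_spectrum W a" by blast
  hence "0 \<le> Sup ((\<lambda>l. ereal (cmod l)) ` m_spectrum W a)"
    by (meson SUP_upper2 norm_ge_zero ereal_less_eq(5))
  hence "m_spectral_radius W a = 0 \<longleftrightarrow> Sup ((\<lambda>l. ereal (cmod l)) ` m_spectrum W a) \<le> 0"
    using False by (auto simp: m_spectral_radius_def)
  also have "\<dots> \<longleftrightarrow> m_spectrum W a \<subseteq> {0}"
    by (auto simp: Sup_le_iff)
  finally show ?thesis .
qed (simp add: m_spectral_radius_def)

lemma m_spectral_radius_eq_0_iff: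
  assumes "W \<in> carrier_mat n n" "a \<in> carrier_vec n"
  shows "m_spectral_radius W a = 0 \<longleftrightarrow> \<not> (\<exists>l. l \<noteq> 0 \<and> eigenvalue (W * diag_of a) l)"
  using m_spectrum_nonzero_iff_eigenvalue[OF assms] by (auto simp: m_spectral_radius_eq_0_iff_subset)

lemma m_spectral_radius_eq_0_if_mult_eq_0:
  assumes W: "W \<in> carrier_mat n n" and x: "x \<in> carrier_vec n"
    and zero: "\<And>y. y \<in> carrier_vec n \<Longrightarrow> evo_mult W x y = 0\<^sub>v n"
  shows "m_spectral_radius W x = 0"
proof -
  have "l = 0" if "eigenvalue (W * diag_of x) l" for l
  proof -
    obtain v where v: "v \<in> carrier_vec n" "v \<noteq> 0\<^sub>v n" "(W * diag_of x) *\<^sub>v v = l \<cdot>\<^sub>v v"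
      using \<open>eigenvalue _ l\<close> W x by (auto simp: eigenvalue_def eigenvector_def)
    obtain j where j: "j < n" "v $ j \<noteq> 0" using ex_index_nonzero_vec[OF v(1,2)] .
    have "l \<cdot>\<^sub>v v = 0\<^sub>v n" using v zero evo_mult_eq_mult_diag_of[OF W x] by simp
    hence "(l \<cdot>\<^sub>v v) $ j = 0" using j by simp
    hence "l * v $ j = 0" using j v(1) by simp
    thus "l = 0" using j by simp
  qed
  thus ?thesis using m_spectral_radius_eq_0_iff[OF W x] by blast
qed

subsection \<open>Ideals and descendents\<close>

lemma col_mem_evo_ideal:
  assumes W: "W \<in> carrier_mat n n" and I: "evo_ideal W I" and y: "y \<in> I"
    and k: "k < n" and yk: "y $ k \<noteq> 0"
  shows "col W k \<in> I"
proof -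
  have "y \<in> carrier_vec n" using I W y by (auto simp: evo_ideal_def)
  hence "evo_mult W (unit_vec n k) y = y $ k \<cdot>\<^sub>v col W k"
    using evo_mult_unit_vec[OF W _ k, where c = 1] by simp
  moreover have "evo_mult W (unit_vec n k) y \<in> I" using I W y by (simp add: evo_ideal_def)
  ultimately have "(1 / y $ k) \<cdot>\<^sub>v (y $ k \<cdot>\<^sub>v col W k) \<in> I" using I by (simp add: evo_ideal_def)
  thus ?thesis using yk by (simp add: smult_smult_assoc)
qed

lemma col_mem_evo_ideal_descendents:
  assumes W: "W \<in> carrier_mat n n" and I: "evo_ideal W I"
    and i: "col W i \<in> I" and j: "j \<in> descendents W i"
  shows "col W j \<in> I"
proof -
  have "(i, j) \<in> (desc_rel W)\<^sup>+" using j by (simp add: descendents_def)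
  thus ?thesis
  proof (induction rule: trancl_induct)
    case (base k)
    thus ?case using W col_mem_evo_ideal[OF W I i, of k] by (simp add: desc_rel_def)
  next
    case (step k k')
    thus ?case using W col_mem_evo_ideal[OF W I step.IH, of k'] by (simp add: desc_rel_def)
  qed
qed

lemma descendents_insert_closed:
  assumes "k \<in> descendents W i \<union> {i}" "k < dim_col W" "j < dim_col W" "W $$ (j, k) \<noteq> 0"
  shows "j \<in> descendents W i \<union> {i}"
proof -
  have "(k, j) \<in> desc_rel W" using assms by (simp add: desc_rel_def)
  thus ?thesis using assms(1) by (auto simp: descendents_def intro: trancl_into_trancl)
qed

lemma finsum_vec_smult_col:
  assumes W: "W \<in> carrier_mat n n"
  shows "finsum_vec TYPE(complex) n (\<lambda>j. c j \<cdot>\<^sub>v col W j) (S \<inter> {..<n})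
    = W *\<^sub>v vec n (\<lambda>j. if j \<in> S then c j else 0)"
proof (rule eq_vecI)
  have cols: "(\<lambda>j. c j \<cdot>\<^sub>v col W j) \<in> S \<inter> {..<n} \<rightarrow> carrier_vec n" using W by auto
  fix i assume "i < dim_vec (W *\<^sub>v vec n (\<lambda>j. if j \<in> S then c j else 0))"
  hence i: "i < n" using W by simp
  have "finsum_vec TYPE(complex) n (\<lambda>j. c j \<cdot>\<^sub>v col W j) (S \<inter> {..<n}) $ i
      = (\<Sum>j\<in>S \<inter> {..<n}. c j * W $$ (i, j))"
    using index_finsum_vec[OF _ i cols] W i by simp
  also have "\<dots> = (\<Sum>j<n. if j \<in> S then c j * W $$ (i, j) else 0)"
    by (simp add: sum.If_cases Int_commute)
  also have "\<dots> = (W *\<^sub>v vec n (\<lambda>j. if j \<in> S then c j else 0)) $ i"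
    using W i by (auto simp: scalar_prod_def atLeast0LessThan intro!: sum.cong)
  finally show "finsum_vec TYPE(complex) n (\<lambda>j. c j \<cdot>\<^sub>v col W j) (S \<inter> {..<n}) $ i
      = (W *\<^sub>v vec n (\<lambda>j. if j \<in> S then c j else 0)) $ i" .
qed (use W finsum_vec_closed[of "\<lambda>j. c j \<cdot>\<^sub>v col W j" "S \<inter> {..<n}" n] in auto)

lemma lin_squares_eq:
  assumes W: "W \<in> carrier_mat n n"
  shows "lin_squares W S = {W *\<^sub>v v | v. v \<in> carrier_vec n \<and> (\<forall>j<n. j \<notin> S \<longrightarrow> v $ j = 0)}"
proof (intro equalityI subsetI)
  fix x assume "x \<in> lin_squares W S"
  then obtain c where "x = finsum_vec TYPE(complex) n (\<lambda>j. c j \<cdot>\<^sub>v col W j) (S \<inter> {..<n})"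
    using W by (auto simp: lin_squares_def)
  thus "x \<in> {W *\<^sub>v v | v. v \<in> carrier_vec n \<and> (\<forall>j<n. j \<notin> S \<longrightarrow> v $ j = 0)}"
    using finsum_vec_smult_col[OF W] by auto
next
  fix x assume "x \<in> {W *\<^sub>v v | v. v \<in> carrier_vec n \<and> (\<forall>j<n. j \<notin> S \<longrightarrow> v $ j = 0)}"
  then obtain v where v: "x = W *\<^sub>v v" "v \<in> carrier_vec n" "\<forall>j<n. j \<notin> S \<longrightarrow> v $ j = 0" by blast
  have "vec n (\<lambda>j. if j \<in> S then v $ j else 0) = v" using v by (intro eq_vecI) auto
  hence "x = finsum_vec TYPE(complex) n (\<lambda>j. v $ j \<cdot>\<^sub>v col W j) (S \<inter> {..<n})"
    using finsum_vec_smult_col[OF W, of "\<lambda>j. v $ j" S] v(1) by simp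
  thus "x \<in> lin_squares W S" using W by (auto simp: lin_squares_def)
qed

lemma lin_squares_subset_evo_ideal:
  assumes W: "W \<in> carrier_mat n n" and I: "evo_ideal W I"
    and cols: "\<And>j. j \<in> S \<Longrightarrow> j < n \<Longrightarrow> col W j \<in> I"
  shows "lin_squares W S \<subseteq> I"
proof
  fix x assume "x \<in> lin_squares W S"
  then obtain v where v: "x = W *\<^sub>v v" "v \<in> carrier_vec n" "\<forall>j<n. j \<notin> S \<longrightarrow> v $ j = 0"
    unfolding lin_squares_eq[OF W] by blast
  have partial: "W *\<^sub>v vec n (\<lambda>j. if j \<in> F then v $ j else 0) \<in> I" if F: "F \<subseteq> S \<inter> {..<n}" for F
  proof -
    have "finite F" using F finite_subset by blast
    thus ?thesis using F
    proof (induction F rule: finite_induct)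
      case empty
      have "vec n (\<lambda>j. if j \<in> {} then v $ j else 0) = 0\<^sub>v n" by (intro eq_vecI) auto
      moreover have "W *\<^sub>v 0\<^sub>v n = 0\<^sub>v n" using W by auto
      ultimately show ?case using I W by (simp add: evo_ideal_def)
    next
      case (insert k F)
      hence k: "k < n" "k \<in> S" by auto
      have "vec n (\<lambda>j. if j \<in> insert k F then v $ j else 0)
          = vec n (\<lambda>j. if j \<in> F then v $ j else 0) + v $ k \<cdot>\<^sub>v unit_vec n k"
        using insert.hyps(2) k by (intro eq_vecI) auto
      hence "W *\<^sub>v vec n (\<lambda>j. if j \<in> insert k F then v $ j else 0)
          = W *\<^sub>v vec n (\<lambda>j. if j \<in> F then v $ j else 0) + v $ k \<cdot>\<^sub>v col W k"
        using W k by (simp add: mult_add_distrib_mat_vec[OF W] mult_mat_vec[OF W] mult_mat_vec_unit_vec)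
      moreover have "v $ k \<cdot>\<^sub>v col W k \<in> I" using cols[OF k(2,1)] I by (simp add: evo_ideal_def)
      ultimately show ?case using insert I by (simp add: evo_ideal_def)
    qed
  qed
  have "vec n (\<lambda>j. if j \<in> S \<inter> {..<n} then v $ j else 0) = v" using v by (intro eq_vecI) auto
  thus "x \<in> I" using partial[of "S \<inter> {..<n}"] v(1) by simp
qed

lemma lin_squares_supported:
  assumes W: "W \<in> carrier_mat n n"
    and closed: "\<And>j k. k \<in> S \<Longrightarrow> k < n \<Longrightarrow> j < n \<Longrightarrow> W $$ (j, k) \<noteq> 0 \<Longrightarrow> j \<in> S"
    and x: "x \<in> lin_squares W S" and j: "j < n" "j \<notin> S"
  shows "x $ j = 0"
proof -
  obtain v where v: "x = W *\<^sub>v v" "v \<in> carrier_vec n" "\<forall>k<n. k \<notin> S \<longrightarrow> v $ k = 0"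
    using x unfolding lin_squares_eq[OF W] by blast
  have "W $$ (j, k) * v $ k = 0" if "k < n" for k
    using closed[of k j] j v(3) that by (cases "k \<in> S") auto
  hence "(\<Sum>k<n. W $$ (j, k) * v $ k) = 0" by (intro sum.neutral) simp
  thus ?thesis using v W j by (simp add: scalar_prod_def atLeast0LessThan)
qed

lemma evo_ideal_lin_squares:
  assumes W: "W \<in> carrier_mat n n"
    and closed: "\<And>j k. k \<in> S \<Longrightarrow> k < n \<Longrightarrow> j < n \<Longrightarrow> W $$ (j, k) \<noteq> 0 \<Longrightarrow> j \<in> S"
  shows "evo_ideal W (lin_squares W S)"
  unfolding evo_ideal_def
proof (intro conjI ballI allI)
  let ?supp = "\<lambda>v. v \<in> carrier_vec n \<and> (\<forall>j<n. j \<notin> S \<longrightarrow> v $ j = 0)"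
  have L: "lin_squares W S = {W *\<^sub>v v | v. ?supp v}" by (rule lin_squares_eq[OF W])
  show "lin_squares W S \<subseteq> carrier_vec (dim_col W)" using W by (auto simp: L)
  have "?supp (0\<^sub>v n)" "0\<^sub>v n = W *\<^sub>v 0\<^sub>v n" using W by auto
  hence "0\<^sub>v n \<in> lin_squares W S" unfolding L by blast
  thus "0\<^sub>v (dim_col W) \<in> lin_squares W S" using W by simp
  show "x + y \<in> lin_squares W S" if xy: "x \<in> lin_squares W S" "y \<in> lin_squares W S" for x y
  proof -
    obtain v w where "x = W *\<^sub>v v" "?supp v" "y = W *\<^sub>v w" "?supp w" using xy unfolding L by blast
    hence "x + y = W *\<^sub>v (v + w)" "?supp (v + w)" using W by (auto simp: mult_add_distrib_mat_vec[OF W])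
    thus ?thesis unfolding L by blast
  qed
  show "c \<cdot>\<^sub>v x \<in> lin_squares W S" if x: "x \<in> lin_squares W S" for c x
  proof -
    obtain v where "x = W *\<^sub>v v" "?supp v" using x unfolding L by blast
    hence "c \<cdot>\<^sub>v x = W *\<^sub>v (c \<cdot>\<^sub>v v)" "?supp (c \<cdot>\<^sub>v v)" using W by (auto simp: mult_mat_vec[OF W])
    thus ?thesis unfolding L by blast
  qed
  fix a x assume "x \<in> lin_squares W S"
  hence "?supp (vec n (\<lambda>j. a $ j * x $ j))" using lin_squares_supported[OF W closed] by auto
  moreover have "evo_mult W a x = W *\<^sub>v vec n (\<lambda>j. a $ j * x $ j)" using W by (simp add: evo_mult_def)
  ultimately show "evo_mult W a x \<in> lin_squares W S" unfolding L by blast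
  thus "evo_mult W x a \<in> lin_squares W S" by (simp add: evo_mult_commute)
qed

lemma evo_mult_unit_vec_eq_0:
  assumes "W \<in> carrier_mat n n" "y \<in> carrier_vec n" "k < n" "col W k = 0\<^sub>v n"
  shows "evo_mult W (c \<cdot>\<^sub>v unit_vec n k) y = 0\<^sub>v n"
  using evo_mult_unit_vec[OF assms(1-3)] assms(4) by (auto intro!: eq_vecI)

lemma evo_ideal_line_unit_vec:
  assumes W: "W \<in> carrier_mat n n" and i: "i < n" and sq: "col W i = 0\<^sub>v n"
  shows "evo_ideal W (range (\<lambda>c. c \<cdot>\<^sub>v unit_vec n i))"
  unfolding evo_ideal_def
proof (intro conjI ballI allI)
  let ?L = "range (\<lambda>c :: complex. c \<cdot>\<^sub>v unit_vec n i)"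
  have zero: "0\<^sub>v n \<in> ?L"
  proof (rule range_eqI)
    show "0\<^sub>v n = (0 :: complex) \<cdot>\<^sub>v unit_vec n i" by (intro eq_vecI) auto
  qed
  thus "0\<^sub>v (dim_col W) \<in> ?L" using W by simp
  fix a x :: "complex vec" assume a: "a \<in> carrier_vec (dim_col W)" and "x \<in> ?L"
  then obtain c where "x = c \<cdot>\<^sub>v unit_vec n i" by blast
  hence "evo_mult W x a = 0\<^sub>v n" using evo_mult_unit_vec_eq_0[OF W _ i sq] a W by simp
  thus "evo_mult W x a \<in> ?L" "evo_mult W a x \<in> ?L"
    using zero by (simp_all add: evo_mult_commute)
qed (use W in \<open>auto simp: add_smult_distrib_vec[symmetric] smult_smult_assoc\<close>)

subsection \<open>The characterisation of m-semisimplicity\<close>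

lemma m_semisimple_if_squares_have_eigenvalues:
  assumes W: "W \<in> carrier_mat n n"
    and eig: "\<forall>i<n. \<exists>a \<in> lin_squares W (descendents W i \<union> {i}).
        \<exists>l. l \<noteq> 0 \<and> eigenvalue (W * diag_of a) l"
  shows "m_semisimple W"
  unfolding m_semisimple_def
proof (intro allI impI)
  fix I assume "evo_ideal W I \<and> I \<subseteq> {a \<in> carrier_vec (dim_col W). m_spectral_radius W a = 0}"
  hence I: "evo_ideal W I" and rad: "I \<subseteq> {a \<in> carrier_vec n. m_spectral_radius W a = 0}"
    using W by auto
  have "x = 0\<^sub>v n" if x: "x \<in> I" for x
  proof (rule ccontr)
    assume nonzero: "x \<noteq> 0\<^sub>v n"
    have "x \<in> carrier_vec n" using x rad by blast
    then obtain i where i: "i < n" "x $ i \<noteq> 0" using nonzero by (rule ex_index_nonzero_vec)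
    let ?S = "descendents W i \<union> {i}"
    have col_i: "col W i \<in> I" by (rule col_mem_evo_ideal[OF W I x i])
    have cols: "col W j \<in> I" if "j \<in> ?S" for j
      using that col_i col_mem_evo_ideal_descendents[OF W I col_i] by auto
    have "lin_squares W ?S \<subseteq> I" by (intro lin_squares_subset_evo_ideal[OF W I] cols)
    moreover from eig i obtain a l
      where a: "a \<in> lin_squares W ?S" and l: "l \<noteq> 0" "eigenvalue (W * diag_of a) l"
      by blast
    ultimately have "a \<in> carrier_vec n" "m_spectral_radius W a = 0" using rad by auto
    thus False using m_spectral_radius_eq_0_iff[OF W] l by blast
  qed
  moreover have "0\<^sub>v n \<in> I" using I W by (simp add: evo_ideal_def)
  ultimately have "I = {0\<^sub>v n}" by blast
  thus "I = {0\<^sub>v (dim_col W)}" using W by simp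
qed

lemma squares_have_eigenvalues_if_m_semisimple:
  assumes W: "W \<in> carrier_mat n n" and ss: "m_semisimple W" and i: "i < n"
  shows "\<exists>a \<in> lin_squares W (descendents W i \<union> {i}). \<exists>l. l \<noteq> 0 \<and> eigenvalue (W * diag_of a) l"
proof (rule ccontr)
  let ?S = "descendents W i \<union> {i}"
  assume no_eig: "\<not> ?thesis"
  have zero_ideal: "I = {0\<^sub>v n}"
    if "evo_ideal W I" "\<And>x. x \<in> I \<Longrightarrow> m_spectral_radius W x = 0" for I
  proof -
    have "I \<subseteq> carrier_vec n" using that(1) W by (simp add: evo_ideal_def)
    thus ?thesis using ss that W unfolding m_semisimple_def by auto
  qed
  show False
  proof (cases "col W i = 0\<^sub>v n")
    case True
    let ?I = "range (\<lambda>c :: complex. c \<cdot>\<^sub>v unit_vec n i)"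
    have "m_spectral_radius W x = 0" if "x \<in> ?I" for x
      using that m_spectral_radius_eq_0_if_mult_eq_0[OF W _ evo_mult_unit_vec_eq_0[OF W _ i True]]
      by auto
    hence "?I = {0\<^sub>v n}" using zero_ideal evo_ideal_line_unit_vec[OF W i True] by blast
    moreover have "unit_vec n i \<in> ?I" by (rule range_eqI[of _ _ 1]) simp
    ultimately show False using i by auto
  next
    case False
    have "evo_ideal W (lin_squares W ?S)"
      by (rule evo_ideal_lin_squares[OF W], rule descendents_insert_closed) (use W in auto)
    moreover have "m_spectral_radius W x = 0" if x: "x \<in> lin_squares W ?S" for x
    proof -
      have "x \<in> carrier_vec n" using x W by (auto simp: lin_squares_eq[OF W])
      thus ?thesis using x no_eig m_spectral_radius_eq_0_iff[OF W] by blast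
    qed
    ultimately have "lin_squares W ?S = {0\<^sub>v n}" by (rule zero_ideal)
    moreover have "col W i \<in> lin_squares W ?S"
      unfolding lin_squares_eq[OF W] using mult_mat_vec_unit_vec[OF W i] i
      by (intro CollectI exI[of _ "unit_vec n i"]) auto
    ultimately show False using False by auto
  qed
qed

theorem corollary5p9:
  fixes W :: "complex mat" and n :: nat
  assumes "W \<in> carrier_mat n n"
  shows "m_semisimple W \<longleftrightarrow>
    (\<forall>i<n. \<exists>a \<in> lin_squares W (descendents W i \<union> {i}).
        \<exists>l. l \<noteq> 0 \<and> eigenvalue (W * diag_of a) l)"
  using m_semisimple_if_squares_have_eigenvalues[OF assms]
    squares_have_eigenvalues_if_m_semisimple[OF assms] by blast

end
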